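(* Let $\{X_{ij}; i,j\ge 1\}$ be an infinite array of iid real-valued random variables on a probability space with probability measure $P$, having a common general distribution function $F$. Let $X$ be a random variable with distribution function $F$, let $S(x)\equiv P(X\ge x)$ for $x\in\mathbb{R}$, and let $\gamma\equiv -E\log[S(X)]$. For $k,n\ge1$ let $\mathcal{P}_{k,n}\subset\{1,\ldots,n\}$ be the random set of indices of the vectors that are maxima (in the strong sense) with respect to $X_1^k,\ldots,X_n^k$, where $X_i^k\equiv(X_{i1},\ldots,X_{ik})$. Let $k_1,k_2,\ldots$ be a sequence of positive integers. (a) If $\liminf_{n\to\infty}\frac{k_n}{\log(n)}>\gamma^{-1}$, then $\mathbf{1}_{\mathcal{P}_{k_n,n}}(1)\to 1$ as $n\to\infty$, $P$-almost surely. (b) If $\limsup_{n\to\infty}\frac{k_n}{\log(n)}<\gamma^{-1}$, then $\mathbf{1}_{\mathcal{P}_{k_n,n}}(1)\to 0$ as $n\to\infty$, $P$-almost surely.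
   Context: For $a,b\in\mathbb{R}^k$ write $a\preceq b$ iff $a_i\le b_i$ for all $1\le i\le k$ (product order). Given vectors $x_1,\ldots,x_n\in\mathbb{R}^k$, $x_i$ is a (strong) maximum with respect to $x_1,\ldots,x_n$ iff there is no $j\ne i$ with $x_i\preceq x_j$. Thus $1\in\mathcal{P}_{k,n}$ iff $X_1^k\not\preceq X_j^k$ for all $2\le j\le n$. For a set $A$, $\mathbf{1}_A(a)$ equals $1$ if $a\in A$ and $0$ otherwise. $\gamma^{-1}$ denotes the reciprocal $1/\gamma$. *)

theory Defs
  imports "HOL-Probability.Probability"
begin

text \<open>
  A vector in \<open>\<real>\<^sup>k\<close> is a function on \<open>nat\<close> of which only the coordinates \<open>1, \<dots>, k\<close> are read;
  the dimension is a term because it has to vary inside the statement. Families of vectors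
  and the coordinates of each vector are indexed from 1.
\<close>

definition prod_le :: "nat \<Rightarrow> (nat \<Rightarrow> real) \<Rightarrow> (nat \<Rightarrow> real) \<Rightarrow> bool" where
  "prod_le k a b \<longleftrightarrow> (\<forall>i\<in>{1..k}. a i \<le> b i)"

definition is_strong_max :: "nat \<Rightarrow> nat \<Rightarrow> (nat \<Rightarrow> nat \<Rightarrow> real) \<Rightarrow> nat \<Rightarrow> bool" where
  "is_strong_max k n x i \<longleftrightarrow> \<not> (\<exists>j\<in>{1..n}. j \<noteq> i \<and> prod_le k (x i) (x j))"

definition maxima :: "nat \<Rightarrow> nat \<Rightarrow> (nat \<Rightarrow> nat \<Rightarrow> real) \<Rightarrow> nat set" where
  "maxima k n x = {i\<in>{1..n}. is_strong_max k n x i}"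

definition surv :: "'a measure \<Rightarrow> ('a \<Rightarrow> real) \<Rightarrow> real \<Rightarrow> real" where
  "surv M X x = measure M {\<omega> \<in> space M. X \<omega> \<ge> x}"

text \<open>
  \<open>surv M X (X \<omega>)\<close> is almost surely positive and stochastically dominates a uniform variable on
  \<open>(0, 1)\<close>. Hence the integrand below is integrable and \<open>0 \<le> gam M X \<le> 1\<close>, with \<open>gam M X = 0\<close>
  exactly when \<open>X\<close> is almost surely constant; so reciprocals of \<open>gam M X\<close> should be taken
  in \<open>ereal\<close>, where \<open>1 / 0 = \<infinity>\<close>, and not in \<open>real\<close>, where \<open>1 / 0 = 0\<close>.
\<close>

definition gam :: "'a measure \<Rightarrow> ('a \<Rightarrow> real) \<Rightarrow> real" where
  "gam M X = - (\<integral>\<omega>. ln (surv M X (X \<omega>)) \<partial>M)"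

end

theory Submission
  imports Defs
begin

text \<open>
  Write \<open>S x = P (X \<ge> x)\<close> and let \<open>Q m\<close> be the product of the \<open>S x\<close> over the first \<open>m\<close> coordinates
  \<open>x\<close> of the first vector. Conditionally on that vector, each other vector dominates it in dimension \<open>m\<close>
  independently with probability \<open>Q m\<close>. Since \<open>S X\<close> stochastically
  dominates a uniform variable, \<open>- ln (S X)\<close> has exponential moments; a Chernoff bound then gives
  \<open>Q m = exp (- (\<gamma> + o(1)) m)\<close> almost surely. Hence about \<open>exp (\<gamma> m)\<close> vectors are needed before
  one of them dominates the first. With \<open>exp (m / c)\<close> vectors, the conditional probability of the unlikely
  event is summable in \<open>m\<close> whenever \<open>1 / c \<noteq> \<gamma>\<close>, so Borel--Cantelli applies along \<open>m\<close>. Dominance is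
  decreasing in the dimension and more likely with more vectors, which transfers this to \<open>m = k n\<close> in (a)
  and to \<open>m = \<lfloor>c ln n\<rfloor> \<ge> k n\<close> in (b), for \<open>k\<close> not necessarily monotone.
\<close>

subsection \<open>Exponential bounds and conditioning\<close>

text \<open>Beyond the linear term, the power series of \<open>exp (s * z)\<close> is compared
  termwise with that of \<open>exp \<bar>z\<bar>\<close>: a term of order \<open>n + 2\<close>
  carries \<open>s ^ (n + 2)\<close>, which is at most \<open>s ^ 2\<close>. Taking expectations
  makes the error quadratic in \<open>s\<close>.\<close>

lemma exp_mult_le:
  fixes s z :: real
  assumes "0 \<le> s" "s \<le> 1"
  shows "exp (s * z) \<le> 1 + s * z + s\<^sup>2 * exp \<bar>z\<bar>"
proof -
  have e: "(\<lambda>n. x ^ (n + 2) / fact (n + 2)) sums (exp x - 1 - x)" for x :: real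
    using sums_split_initial_segment[OF exp_converges[of x], of 2]
    by (simp add: divide_inverse mult.commute scaleR_conv_of_real eval_nat_numeral diff_diff_eq)
  have "exp (s * z) - 1 - s * z \<le> s\<^sup>2 * (exp \<bar>z\<bar> - 1 - \<bar>z\<bar>)"
  proof (rule sums_le[OF _ e[of "s * z"] sums_mult[OF e[of "\<bar>z\<bar>"]]])
    fix n
    have "(s * z) ^ (n + 2) \<le> \<bar>s * z\<bar> ^ (n + 2)"
      by (metis abs_ge_self power_abs)
    also have "\<dots> = s ^ n * (s\<^sup>2 * \<bar>z\<bar> ^ (n + 2))"
      using assms by (simp add: abs_mult power_mult_distrib power_add power2_eq_square)
    also have "\<dots> \<le> 1 * (s\<^sup>2 * \<bar>z\<bar> ^ (n + 2))"
      using assms by (intro mult_right_mono power_le_one) auto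
    finally show "(s * z) ^ (n + 2) / fact (n + 2) \<le> s\<^sup>2 * (\<bar>z\<bar> ^ (n + 2) / fact (n + 2))"
      by (simp add: divide_right_mono)
  qed
  also have "\<dots> \<le> s\<^sup>2 * exp \<bar>z\<bar>"
    by (intro mult_left_mono) auto
  finally show ?thesis by simp
qed

text \<open>First Borel--Cantelli lemma, in the form needed for explicit bounds.\<close>

lemma AE_eventually_not_if_summable_bound:
  fixes b :: "nat \<Rightarrow> real"
  assumes "finite_measure M" and "\<And>n. {\<omega> \<in> space M. P n \<omega>} \<in> sets M"
    and "\<And>n. measure M {\<omega> \<in> space M. P n \<omega>} \<le> b n" and "summable b"
  shows "AE \<omega> in M. eventually (\<lambda>n. \<not> P n \<omega>) sequentially"
proof -
  interpret finite_measure M by fact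
  have "summable (\<lambda>n. measure M {\<omega> \<in> space M. P n \<omega>})"
    using assms(3) by (intro summable_comparison_test'[OF assms(4)]) simp
  from borel_cantelli_AE1[OF assms(2) _ this]
  have "AE \<omega> in M. eventually (\<lambda>n. \<omega> \<in> space M - {\<omega> \<in> space M. P n \<omega>}) sequentially"
    by (simp add: emeasure_eq_measure)
  then show ?thesis
    by eventually_elim (auto elim: eventually_mono)
qed

context prob_space
begin

text \<open>Chernoff bound: a negative mean makes the moment generating function of
  \<open>Z0\<close> smaller than 1 at some small \<open>s > 0\<close>, and independence turns it
  into a power. The ratio \<open>\<rho>\<close> is this value, so it depends on the common law but
  not on \<open>J\<close>.\<close>

lemma exponential_decay_of_negative_mean:
  fixes Z :: "'i \<Rightarrow> 'a \<Rightarrow> real"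
  assumes indep: "indep_vars (\<lambda>_. borel) Z I"
    and Z0[measurable]: "random_variable borel Z0"
    and law: "\<And>i. i \<in> I \<Longrightarrow> distr M borel (Z i) = distr M borel Z0"
    and int: "integrable M (\<lambda>\<omega>. exp \<bar>Z0 \<omega>\<bar>)"
    and neg: "expectation Z0 < 0"
  shows "\<exists>\<rho>. 0 \<le> \<rho> \<and> \<rho> < 1 \<and>
    (\<forall>J. finite J \<and> J \<subseteq> I \<longrightarrow> prob {\<omega> \<in> space M. 0 \<le> (\<Sum>i\<in>J. Z i \<omega>)} \<le> \<rho> ^ card J)"
proof -
  define C where "C = expectation (\<lambda>\<omega>. exp \<bar>Z0 \<omega>\<bar>)"
  define \<mu> where "\<mu> = expectation Z0"
  have intZ: "integrable M Z0"
  proof (rule Bochner_Integration.integrable_bound[OF int])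
    have "\<bar>z\<bar> \<le> exp \<bar>z\<bar>" for z :: real
      using exp_ge_add_one_self[of "\<bar>z\<bar>"] by linarith
    then show "AE x in M. norm (Z0 x) \<le> norm (exp \<bar>Z0 x\<bar>)"
      by simp
  qed simp
  have C: "0 \<le> C"
    unfolding C_def by simp
  \<comment> \<open>The second argument gives \<open>s * C \<le> - \<mu> / 2\<close>, so the
    quadratic error cannot cancel the negative drift. The cap 1 is what \<open>exp_mult_le\<close>
    and the domination by \<open>exp \<bar>Z0\<bar>\<close> require.\<close>
  define s where "s = min 1 (- \<mu> / (2 * (C + 1)))"
  have s: "0 < s" "s \<le> 1"
    using neg C by (auto simp: s_def \<mu>_def divide_simps)
  have "s * C \<le> - \<mu> / 2"
  proof -
    have "s * C \<le> - \<mu> / (2 * (C + 1)) * (C + 1)"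
      using C s by (intro mult_mono) (auto simp: s_def)
    also have "\<dots> = - \<mu> / 2"
      using C by (simp add: field_simps)
    finally show ?thesis .
  qed
  then have sC: "\<mu> + s * C < 0"
    using neg by (simp add: \<mu>_def)
  define \<rho> where "\<rho> = expectation (\<lambda>\<omega>. exp (s * Z0 \<omega>))"
  have int_s: "integrable M (\<lambda>\<omega>. exp (s * Z0 \<omega>))"
  proof (rule Bochner_Integration.integrable_bound[OF int])
    have "s * z \<le> \<bar>z\<bar>" for z
      using s mult_left_le_one_le[of "\<bar>z\<bar>" s] mult_left_mono[of z "\<bar>z\<bar>" s] by linarith
    then show "AE x in M. norm (exp (s * Z0 x)) \<le> norm (exp \<bar>Z0 x\<bar>)"
      by simp
  qed simp
  have "\<rho> \<le> expectation (\<lambda>\<omega>. 1 + s * Z0 \<omega> + s\<^sup>2 * exp \<bar>Z0 \<omega>\<bar>)"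
    unfolding \<rho>_def using s int intZ int_s by (intro integral_mono exp_mult_le) auto
  also have "\<dots> = 1 + s * (\<mu> + s * C)"
    using int intZ by (simp add: C_def \<mu>_def prob_space algebra_simps power2_eq_square)
  finally have \<rho>1: "\<rho> < 1"
    using s sC by (smt (verit) mult_pos_neg)
  have \<rho>0: "0 \<le> \<rho>"
    unfolding \<rho>_def by simp
  have "prob {\<omega> \<in> space M. 0 \<le> (\<Sum>i\<in>J. Z i \<omega>)} \<le> \<rho> ^ card J" if J: "finite J" "J \<subseteq> I" for J
  proof -
    have indJ: "indep_vars (\<lambda>_. borel) (\<lambda>i \<omega>. exp (s * Z i \<omega>)) J"
      by (rule indep_vars_compose2[OF indep_vars_subset[OF indep J(2)], where N = "\<lambda>_. borel"]) simp
    have rv[measurable]: "random_variable borel (Z i)" if "i \<in> J" for i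
      using indep J(2) that by (auto simp: indep_vars_def)
    have each: "integrable M (\<lambda>\<omega>. exp (s * Z i \<omega>))" "expectation (\<lambda>\<omega>. exp (s * Z i \<omega>)) = \<rho>"
      if i: "i \<in> J" for i
    proof -
      have iI: "i \<in> I" using i J by auto
      note [measurable] = rv[OF i]
      have "integrable (distr M borel (Z i)) (\<lambda>z. exp (s * z))"
        using int_s by (simp add: law[OF iI] integrable_distr_eq)
      then show "integrable M (\<lambda>\<omega>. exp (s * Z i \<omega>))"
        by (simp add: integrable_distr_eq)
      have "expectation (\<lambda>\<omega>. exp (s * Z i \<omega>)) = integral\<^sup>L (distr M borel (Z i)) (\<lambda>z. exp (s * z))"
        by (simp add: integral_distr)
      also have "\<dots> = \<rho>"
        by (simp add: law[OF iI] integral_distr \<rho>_def)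
      finally show "expectation (\<lambda>\<omega>. exp (s * Z i \<omega>)) = \<rho>" .
    qed
    \<comment> \<open>Exponentiating the event turns the sum into a product of independent factors,
      to which Markov's inequality applies at level 1.\<close>
    have "{\<omega> \<in> space M. 0 \<le> (\<Sum>i\<in>J. Z i \<omega>)} = {\<omega> \<in> space M. 1 \<le> (\<Prod>i\<in>J. exp (s * Z i \<omega>))}"
      using s J(1) by (auto simp: exp_sum[symmetric] sum_distrib_left[symmetric] zero_le_mult_iff)
    also have "prob \<dots> \<le> expectation (\<lambda>\<omega>. \<Prod>i\<in>J. exp (s * Z i \<omega>)) / 1"
    proof (rule integral_Markov_inequality_measure)
      show "integrable M (\<lambda>\<omega>. \<Prod>i\<in>J. exp (s * Z i \<omega>))"
        using J(1) indJ each by (intro indep_vars_integrable)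
      show "AE x in M. 0 \<le> (\<Prod>i\<in>J. exp (s * Z i x))"
        by (intro AE_I2 prod_nonneg) simp
    qed auto
    also have "\<dots> = \<rho> ^ card J"
      using indep_vars_lebesgue_integral[OF J(1) indJ each(1)] each by simp
    finally show ?thesis .
  qed
  with \<rho>0 \<rho>1 show ?thesis by blast
qed

text \<open>This replaces conditional probability: by independence the joint law is a product
  measure, so Fubini allows \<open>V\<close> to be frozen at a value \<open>v\<close>, and a bound
  uniform in \<open>v\<close> integrates to itself.\<close>

lemma prob_indep_pair_le:
  assumes indep: "indep_var S V T W"
    and A[measurable]: "A \<in> sets (S \<Otimes>\<^sub>M T)"
    and le: "\<And>v. v \<in> space S \<Longrightarrow> prob {\<omega> \<in> space M. (v, W \<omega>) \<in> A} \<le> p"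
    and p: "0 \<le> p"
  shows "prob {\<omega> \<in> space M. (V \<omega>, W \<omega>) \<in> A} \<le> p"
proof -
  have rv[measurable]: "random_variable S V" "random_variable T W"
    and eq: "distr M S V \<Otimes>\<^sub>M distr M T W = distr M (S \<Otimes>\<^sub>M T) (\<lambda>\<omega>. (V \<omega>, W \<omega>))"
    using indep unfolding indep_var_distribution_eq by auto
  interpret V: prob_space "distr M S V" by (rule prob_space_distr) fact
  interpret W: prob_space "distr M T W" by (rule prob_space_distr) fact
  have "emeasure M {\<omega> \<in> space M. (V \<omega>, W \<omega>) \<in> A} = emeasure (distr M S V \<Otimes>\<^sub>M distr M T W) A"
    unfolding eq by (subst emeasure_distr) (auto intro!: arg_cong[where f = "emeasure M"])
  also have "\<dots> = (\<integral>\<^sup>+v. emeasure (distr M T W) (Pair v -` A) \<partial>distr M S V)"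
    by (rule W.emeasure_pair_measure_alt) simp
  also have "\<dots> \<le> (\<integral>\<^sup>+v. ennreal p \<partial>distr M S V)"
  proof (rule nn_integral_mono)
    fix v assume "v \<in> space (distr M S V)"
    then have v: "v \<in> space S" by simp
    have "emeasure (distr M T W) (Pair v -` A) = emeasure M {\<omega> \<in> space M. (v, W \<omega>) \<in> A}"
      using sets_Pair1[OF A] by (subst emeasure_distr) (auto intro!: arg_cong[where f = "emeasure M"])
    also have "\<dots> \<le> ennreal p"
      using le[OF v] by (simp add: emeasure_eq_measure ennreal_leI)
    finally show "emeasure (distr M T W) (Pair v -` A) \<le> ennreal p" .
  qed
  also have "\<dots> = ennreal p"
    using V.emeasure_space_1 by simp
  finally show ?thesis
    using p by (simp add: emeasure_eq_measure)
qed

end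

subsection \<open>The survival function\<close>

context prob_space
begin

lemma surv_antimono:
  assumes [measurable]: "random_variable borel X" and "x \<le> y"
  shows "surv M X y \<le> surv M X x"
  unfolding surv_def using assms(2) by (intro finite_measure_mono) auto

lemma surv_nonneg: "0 \<le> surv M X x"
  by (simp add: surv_def)

lemma surv_le_1: "surv M X x \<le> 1"
  by (simp add: surv_def)

lemma borel_measurable_surv[measurable]:
  assumes "random_variable borel X"
  shows "surv M X \<in> borel_measurable borel"
proof -
  have "(\<lambda>x. - surv M X x) \<in> borel_measurable borel"
    using surv_antimono[OF assms] by (intro borel_measurable_mono) (simp add: mono_def)
  then show ?thesis
    using borel_measurable_uminus by fastforce
qed

text \<open>By inner regularity: a compact \<open>K \<subseteq> {x. surv M X x \<le> u}\<close> has a least element \<open>a\<close>, so that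
  \<open>P (X \<in> K) \<le> P (X \<ge> a) \<le> u\<close>.\<close>

lemma prob_surv_le:
  assumes X[measurable]: "random_variable borel X" and u: "0 \<le> u"
  shows "prob {\<omega> \<in> space M. surv M X (X \<omega>) \<le> u} \<le> u"
proof -
  note [measurable] = borel_measurable_surv[OF X]
  interpret D: prob_space "distr M borel X" by (rule prob_space_distr) fact
  define B where "B = {x. surv M X x \<le> u}"
  have B[measurable]: "B \<in> sets borel"
    unfolding B_def by simp
  have "emeasure M {\<omega> \<in> space M. surv M X (X \<omega>) \<le> u} = emeasure (distr M borel X) B"
    by (subst emeasure_distr) (auto simp: B_def intro!: arg_cong[where f = "emeasure M"])
  also have "\<dots> = (SUP K \<in> {K. K \<subseteq> B \<and> compact K}. emeasure (distr M borel X) K)"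
    using B by (intro inner_regular) auto
  also have "\<dots> \<le> ennreal u"
  proof (rule SUP_least)
    fix K assume "K \<in> {K. K \<subseteq> B \<and> compact K}"
    then have K: "K \<subseteq> B" "compact K" by auto
    show "emeasure (distr M borel X) K \<le> ennreal u"
    proof (cases "K = {}")
      case False
      then obtain a where a: "a \<in> K" "\<And>x. x \<in> K \<Longrightarrow> a \<le> x"
        using compact_attains_inf[OF K(2)] by blast
      have "emeasure (distr M borel X) K \<le> emeasure (distr M borel X) {a..}"
        using a by (intro emeasure_mono) auto
      also have "\<dots> = ennreal (surv M X a)"
        by (subst emeasure_distr)
          (auto simp: surv_def emeasure_eq_measure intro!: arg_cong[where f = prob])
      also have "\<dots> \<le> ennreal u"
        using a(1) K(1) by (auto simp: B_def intro: ennreal_leI)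
      finally show ?thesis .
    qed simp
  qed
  finally show ?thesis
    using u by (simp add: emeasure_eq_measure)
qed

text \<open>The case \<open>u = 0\<close> of \<open>prob_surv_le\<close>. Almost surely the
  logarithm is therefore never taken at 0.\<close>

lemma AE_surv_pos:
  assumes X[measurable]: "random_variable borel X"
  shows "AE \<omega> in M. 0 < surv M X (X \<omega>)"
proof -
  note [measurable] = borel_measurable_surv[OF X]
  have "prob {\<omega> \<in> space M. \<not> 0 < surv M X (X \<omega>)} = 0"
    using prob_surv_le[OF X, of 0] by (simp add: not_less measure_le_0_iff)
  then show ?thesis
    by (subst AE_iff_measurable[OF _ refl]) (auto simp: emeasure_eq_measure)
qed

text \<open>Domination of a uniform variable by \<open>surv M X (X \<omega>)\<close>, read on the
  logarithmic scale: the tail is at most that of a standard exponential variable.\<close>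

lemma prob_neg_ln_surv_ge:
  assumes X[measurable]: "random_variable borel X" and t: "0 \<le> t"
  shows "prob {\<omega> \<in> space M. t \<le> - ln (surv M X (X \<omega>))} \<le> exp (- t)"
proof (cases "t = 0")
  case False
  note [measurable] = borel_measurable_surv[OF X]
  have "surv M X x \<le> exp (- t)" if "t \<le> - ln (surv M X x)" for x
  proof (cases "surv M X x = 0")
    case F: False
    then have "0 < surv M X x"
      using surv_nonneg[of X x] by simp
    then show ?thesis
      using that by (metis exp_le_cancel_iff exp_ln le_minus_iff)
  qed simp
  then have "prob {\<omega> \<in> space M. t \<le> - ln (surv M X (X \<omega>))}
      \<le> prob {\<omega> \<in> space M. surv M X (X \<omega>) \<le> exp (- t)}"
    by (intro finite_measure_mono) auto
  also have "\<dots> \<le> exp (- t)"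
    by (rule prob_surv_le) auto
  finally show ?thesis .
qed simp

text \<open>Holds for every \<open>x\<close>, not just almost surely, because
  \<open>ln 0 = 0\<close>.\<close>

lemma neg_ln_surv_nonneg: "0 \<le> - ln (surv M X x)"
  using surv_nonneg[of X x] surv_le_1[of X x] by (cases "surv M X x = 0") auto

text \<open>The exponent 1/2 lies below the rate 1 of the exponential tail. Slicing by the integer
  part of \<open>Y\<close> bounds the integral by a geometric series with ratio
  \<open>q\<close>.\<close>

lemma integrable_exp_half_neg_ln_surv:
  assumes X[measurable]: "random_variable borel X"
  shows "integrable M (\<lambda>\<omega>. exp (- ln (surv M X (X \<omega>)) / 2))"
proof -
  note [measurable] = borel_measurable_surv[OF X]
  define Y where "Y \<omega> = - ln (surv M X (X \<omega>))" for \<omega>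
  have Y[measurable]: "random_variable borel Y"
    unfolding Y_def by simp
  have Y0: "0 \<le> Y \<omega>" for \<omega>
    using neg_ln_surv_nonneg unfolding Y_def by blast
  define q :: real where "q = exp (- (1 / 2))"
  have q: "0 \<le> q" "q < 1"
    by (auto simp: q_def)
  have "(\<integral>\<^sup>+\<omega>. ennreal (exp (Y \<omega> / 2)) \<partial>M)
      \<le> (\<integral>\<^sup>+\<omega>. (\<Sum>m. ennreal (exp ((real m + 1) / 2)) * indicator {\<omega> \<in> space M. real m \<le> Y \<omega>} \<omega>) \<partial>M)"
  proof (rule nn_integral_mono)
    fix \<omega> assume \<omega>: "\<omega> \<in> space M"
    \<comment> \<open>The single summand whose index is the integer part of
      \<open>Y \<omega>\<close> already dominates the integrand.\<close>
    define n where "n = nat \<lfloor>Y \<omega>\<rfloor>"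
    have n: "real n \<le> Y \<omega>" "Y \<omega> \<le> real n + 1"
      using Y0[of \<omega>] by (auto simp: n_def)
    have "ennreal (exp (Y \<omega> / 2))
        \<le> ennreal (exp ((real n + 1) / 2)) * indicator {\<omega> \<in> space M. real n \<le> Y \<omega>} \<omega>"
      using n \<omega> by (simp add: ennreal_leI)
    also have "\<dots> = (\<Sum>m\<in>{n}. ennreal (exp ((real m + 1) / 2)) * indicator {\<omega> \<in> space M. real m \<le> Y \<omega>} \<omega>)"
      by (simp only: sum.insert finite.emptyI empty_iff not_False_eq_True sum.empty add_0_right)
    also have "\<dots> \<le> (\<Sum>m. ennreal (exp ((real m + 1) / 2)) * indicator {\<omega> \<in> space M. real m \<le> Y \<omega>} \<omega>)"
      by (rule sum_le_suminf) auto
    finally show "ennreal (exp (Y \<omega> / 2))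
      \<le> (\<Sum>m. ennreal (exp ((real m + 1) / 2)) * indicator {\<omega> \<in> space M. real m \<le> Y \<omega>} \<omega>)" .
  qed
  also have "\<dots> = (\<Sum>m. ennreal (exp ((real m + 1) / 2)) * ennreal (prob {\<omega> \<in> space M. real m \<le> Y \<omega>}))"
    by (subst nn_integral_suminf) (auto simp: nn_integral_cmult_indicator emeasure_eq_measure)
  also have "\<dots> \<le> (\<Sum>m. ennreal (exp (1 / 2) * q ^ m))"
  proof (intro suminf_le allI)
    fix m :: nat
    have "exp ((real m + 1) / 2) * prob {\<omega> \<in> space M. real m \<le> Y \<omega>}
        \<le> exp ((real m + 1) / 2) * exp (- real m)"
      unfolding Y_def by (intro mult_left_mono prob_neg_ln_surv_ge) auto
    also have "\<dots> = exp (1 / 2) * q ^ m"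
      by (simp add: q_def exp_of_nat_mult[symmetric] exp_add[symmetric] field_simps)
    finally show "ennreal (exp ((real m + 1) / 2)) * ennreal (prob {\<omega> \<in> space M. real m \<le> Y \<omega>})
        \<le> ennreal (exp (1 / 2) * q ^ m)"
      by (simp add: ennreal_mult[symmetric] ennreal_leI)
  qed auto
  also have "\<dots> < \<infinity>"
    using q by (subst suminf_ennreal2) (auto intro!: summable_mult summable_geometric)
  finally show ?thesis
    unfolding Y_def by (intro integrableI_bounded) (auto simp: Y_def)
qed

text \<open>Makes \<open>gam M X\<close> a genuine expectation, not the default value 0 of an
  undefined integral. Domination comes from \<open>y \<le> 2 * exp (y / 2)\<close>.\<close>

lemma integrable_neg_ln_surv:
  assumes X[measurable]: "random_variable borel X"
  shows "integrable M (\<lambda>\<omega>. - ln (surv M X (X \<omega>)))"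
proof (rule Bochner_Integration.integrable_bound)
  note [measurable] = borel_measurable_surv[OF X]
  show "integrable M (\<lambda>\<omega>. 2 * exp (- ln (surv M X (X \<omega>)) / 2))"
    using integrable_exp_half_neg_ln_surv[OF X] by simp
  have "\<bar>y\<bar> \<le> \<bar>2 * exp (y / 2)\<bar>" if "0 \<le> y" for y :: real
    using exp_ge_add_one_self[of "y / 2"] that by linarith
  from this[OF neg_ln_surv_nonneg]
  show "AE \<omega> in M. norm (- ln (surv M X (X \<omega>))) \<le> norm (2 * exp (- ln (surv M X (X \<omega>)) / 2))"
    unfolding real_norm_def by (intro AE_I2)
  show "(\<lambda>\<omega>. - ln (surv M X (X \<omega>))) \<in> borel_measurable M"
    by simp
qed

lemma gam_eq_expectation: "gam M X = expectation (\<lambda>\<omega>. - ln (surv M X (X \<omega>)))"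
  by (simp add: gam_def)

lemma gam_nonneg: "0 \<le> gam M X"
  unfolding gam_eq_expectation using neg_ln_surv_nonneg by (intro integral_nonneg_AE) blast

end

subsection \<open>Arrays of independent identically distributed variables\<close>

lemma measurable_pred_le:
  fixes f g :: "'a \<Rightarrow> real"
  assumes [measurable]: "f \<in> borel_measurable M" "g \<in> borel_measurable M"
  shows "Measurable.pred M (\<lambda>x. f x \<le> g x)"
  by measurable

text \<open>The first index numbers the vectors, the second their coordinates. \<open>X\<close>
  represents the common law, through which \<open>surv\<close> and \<open>gam\<close> are
  computed.\<close>

locale iid_array = prob_space M for M :: "'a measure" +
  fixes XX :: "nat \<Rightarrow> nat \<Rightarrow> 'a \<Rightarrow> real" and X :: "'a \<Rightarrow> real"
  assumes indep: "indep_vars (\<lambda>_. borel) (\<lambda>(i, j). XX i j) ({1..} \<times> {1..})"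
    and rv_X[measurable]: "random_variable borel X"
    and law: "\<And>i j. i \<ge> 1 \<Longrightarrow> j \<ge> 1 \<Longrightarrow> distr M borel (XX i j) = distr M borel X"
begin

abbreviation S :: "real \<Rightarrow> real" where "S \<equiv> surv M X"

abbreviation dominates :: "nat \<Rightarrow> nat \<Rightarrow> 'a \<Rightarrow> bool" where
  "dominates m j \<omega> \<equiv> prod_le m (\<lambda>i. XX 1 i \<omega>) (\<lambda>i. XX j i \<omega>)"

abbreviation Q :: "nat \<Rightarrow> 'a \<Rightarrow> real" where
  "Q m \<omega> \<equiv> (\<Prod>i\<in>{1..m}. S (XX 1 i \<omega>))"

lemmas measurable_S[measurable] = borel_measurable_surv[OF rv_X]

lemma rv_XX[measurable]:
  assumes "i \<ge> 1" "j \<ge> 1"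
  shows "random_variable borel (XX i j)"
  using indep assms by (auto simp: indep_vars_def)

lemma measurable_dom[measurable]:
  assumes "j \<ge> 1"
  shows "Measurable.pred M (dominates m j)"
  unfolding prod_le_def using assms
  by (intro pred_intros_finite) (auto intro!: measurable_pred_le rv_XX)

lemma measurable_Q[measurable]: "random_variable borel (Q m)"
  by (intro borel_measurable_prod measurable_compose[OF rv_XX measurable_S]) auto

section \<open>Almost sure exponential decay rate of \<open>Q m\<close>\<close>

lemma AE_S_pos: "AE \<omega> in M. \<forall>i\<ge>1. 0 < S (XX 1 i \<omega>)"
proof -
  have "AE \<omega> in M. 0 < S (XX 1 i \<omega>)" if i: "i \<ge> 1" for i
  proof -
    note [measurable] = rv_XX[OF le_refl i, unfolded One_nat_def]
    have "AE x in distr M borel X. 0 < S x"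
      using AE_surv_pos[OF rv_X] by (subst AE_distr_iff) auto
    then have "AE x in distr M borel (XX 1 i). 0 < S x"
      unfolding law[OF le_refl i] .
    then show ?thesis
      by (subst (asm) AE_distr_iff) auto
  qed
  then show ?thesis
    by (auto simp: AE_all_countable)
qed

text \<open>One side of the strong law of large numbers, obtained from the Chernoff bound and
  Borel--Cantelli; the sign \<open>\<sigma>\<close> selects the side.\<close>

lemma AE_eventually_sum_deviation_less:
  fixes \<sigma> \<epsilon> :: real
  assumes \<sigma>: "\<bar>\<sigma>\<bar> = 1" and \<epsilon>: "\<epsilon> > 0"
  shows "AE \<omega> in M. eventually (\<lambda>m. (\<Sum>i=1..m. \<sigma> * (- ln (S (XX 1 i \<omega>)) - gam M X)) < \<epsilon> * real m) sequentially"
proof -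
  \<comment> \<open>Halving keeps \<open>exp \<bar>g (X \<omega>)\<bar>\<close> integrable, since
    the exponential moment at hand has exponent 1/2. The shift by \<open>\<epsilon> / 2\<close>
    turns the centred variable into one with negative mean.\<close>
  define g where "g x = \<sigma> * (- ln (S x) - gam M X) / 2 - \<epsilon> / 2" for x
  have g[measurable]: "g \<in> borel_measurable borel"
    unfolding g_def by measurable
  define I :: "(nat \<times> nat) set" where "I = {1..} \<times> {1..}"
  define Z where "Z p \<omega> = g (case p of (i, j) \<Rightarrow> XX i j \<omega>)" for p \<omega>
  have "indep_vars (\<lambda>_. borel) (\<lambda>p \<omega>. g ((case p of (i, j) \<Rightarrow> XX i j) \<omega>)) I"
    unfolding I_def by (rule indep_vars_compose2[OF indep]) simp
  then have ind: "indep_vars (\<lambda>_. borel) Z I"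
    by (simp add: Z_def[abs_def] case_prod_beta')
  have lawZ: "distr M borel (Z p) = distr M borel (\<lambda>\<omega>. g (X \<omega>))" if pI: "p \<in> I" for p
  proof -
    obtain i j where p: "p = (i, j)" "i \<ge> 1" "j \<ge> 1"
      using pI by (cases p) (auto simp: I_def)
    note [measurable] = rv_XX[OF p(2,3)]
    have "Z p = (\<lambda>\<omega>. g (XX i j \<omega>))"
      by (simp add: Z_def p fun_eq_iff)
    then have "distr M borel (Z p) = distr (distr M borel (XX i j)) borel g"
      by (subst distr_distr) (auto simp: comp_def)
    also have "\<dots> = distr M borel (\<lambda>\<omega>. g (X \<omega>))"
      unfolding law[OF p(2,3)] by (subst distr_distr) (auto simp: comp_def)
    finally show ?thesis .
  qed
  have int: "integrable M (\<lambda>\<omega>. exp \<bar>g (X \<omega>)\<bar>)"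
  proof (rule Bochner_Integration.integrable_bound)
    show "integrable M (\<lambda>\<omega>. exp ((gam M X + \<epsilon>) / 2) * exp (- ln (surv M X (X \<omega>)) / 2))"
      using integrable_exp_half_neg_ln_surv[OF rv_X] by simp
    have "\<bar>g x\<bar> \<le> (gam M X + \<epsilon>) / 2 + - ln (S x) / 2" for x
    proof -
      \<comment> \<open>Only the absolute value of \<open>t\<close> matters, so both signs
        \<open>\<sigma>\<close> are handled at once.\<close>
      have "\<bar>t / 2 - \<epsilon> / 2\<bar> \<le> (a + \<epsilon>) / 2 + y / 2"
        if "\<bar>t\<bar> = \<bar>y - a\<bar>" "0 \<le> a" "0 \<le> y" for t y a :: real
        using that \<epsilon> by (auto simp: abs_real_def field_simps split: if_splits)
      from this[OF _ gam_nonneg neg_ln_surv_nonneg] show ?thesis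
        by (simp add: g_def abs_mult \<sigma>)
    qed
    then show "AE \<omega> in M. norm (exp \<bar>g (X \<omega>)\<bar>)
        \<le> norm (exp ((gam M X + \<epsilon>) / 2) * exp (- ln (surv M X (X \<omega>)) / 2))"
      by (simp add: exp_add[symmetric])
  qed simp
  have "expectation (\<lambda>\<omega>. g (X \<omega>)) = \<sigma> * (expectation (\<lambda>\<omega>. - ln (S (X \<omega>))) - gam M X) / 2 - \<epsilon> / 2"
    unfolding g_def using integrable_neg_ln_surv[OF rv_X] by (simp add: prob_space)
  also have "\<dots> < 0"
    using \<epsilon> by (simp add: gam_eq_expectation)
  finally obtain \<rho> where \<rho>: "0 \<le> \<rho>" "\<rho> < 1"
      "\<And>J. finite J \<Longrightarrow> J \<subseteq> I \<Longrightarrow> prob {\<omega> \<in> space M. 0 \<le> (\<Sum>p\<in>J. Z p \<omega>)} \<le> \<rho> ^ card J"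
    using exponential_decay_of_negative_mean[OF ind _ lawZ int] by auto
  have sum_eq: "(\<Sum>p\<in>{1} \<times> {1..m}. Z p \<omega>) = (\<Sum>i=1..m. g (XX 1 i \<omega>))" for m \<omega>
    by (simp add: Z_def sum.cartesian_product')
  have "AE \<omega> in M. eventually (\<lambda>m. \<not> 0 \<le> (\<Sum>i=1..m. g (XX 1 i \<omega>))) sequentially"
  proof (rule AE_eventually_not_if_summable_bound)
    show "{\<omega> \<in> space M. 0 \<le> (\<Sum>i=1..m. g (XX 1 i \<omega>))} \<in> events" for m
      by (intro borel_measurable_le borel_measurable_sum measurable_compose[OF rv_XX g]) auto
    have "{1} \<times> {1..m} \<subseteq> I" for m
      by (auto simp: I_def)
    then show "prob {\<omega> \<in> space M. 0 \<le> (\<Sum>i=1..m. g (XX 1 i \<omega>))} \<le> \<rho> ^ m" for m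
      using \<rho>(3)[of "{1} \<times> {1..m}"] unfolding sum_eq by simp
    show "summable (\<lambda>m. \<rho> ^ m)"
      using \<rho> by (intro summable_geometric) simp
  qed (rule finite_measure_axioms)
  then show ?thesis
  proof (rule AE_mp, intro AE_I2 impI, elim eventually_mono)
    fix \<omega> m assume neg: "\<not> 0 \<le> (\<Sum>i=1..m. g (XX 1 i \<omega>))"
    have "(\<Sum>i=1..m. g (XX 1 i \<omega>)) = (\<Sum>i=1..m. \<sigma> * (- ln (S (XX 1 i \<omega>)) - gam M X)) / 2 - \<epsilon> * real m / 2"
      unfolding g_def sum_subtractf sum_divide_distrib by simp
    with neg show "(\<Sum>i=1..m. \<sigma> * (- ln (S (XX 1 i \<omega>)) - gam M X)) < \<epsilon> * real m"
      by simp
  qed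
qed

text \<open>The sign 1 yields the lower bound and the sign -1 the upper one, after writing
  \<open>Q m\<close> as the exponential of a sum of logarithms; this needs every factor to be
  positive.\<close>

lemma AE_Q_bounds:
  assumes "\<epsilon> > 0"
  shows "AE \<omega> in M. eventually (\<lambda>m. exp (- (gam M X + \<epsilon>) * real m) \<le> Q m \<omega> \<and>
    Q m \<omega> \<le> exp (- (gam M X - \<epsilon>) * real m)) sequentially"
proof -
  have 1: "AE \<omega> in M. eventually (\<lambda>m. (\<Sum>i=1..m. 1 * (- ln (S (XX 1 i \<omega>)) - gam M X)) < \<epsilon> * real m) sequentially"
    by (rule AE_eventually_sum_deviation_less) (use assms in auto)
  have 2: "AE \<omega> in M. eventually (\<lambda>m. (\<Sum>i=1..m. (-1) * (- ln (S (XX 1 i \<omega>)) - gam M X)) < \<epsilon> * real m) sequentially"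
    by (rule AE_eventually_sum_deviation_less) (use assms in auto)
  from 1 2 AE_S_pos show ?thesis
  proof eventually_elim
    case (elim \<omega>)
    have Q: "Q m \<omega> = exp (\<Sum>i=1..m. ln (S (XX 1 i \<omega>)))" for m
      using elim(3) by (simp add: exp_sum)
    from elim(1,2) show ?case
    proof eventually_elim
      case (elim m)
      then show ?case
        unfolding Q exp_le_cancel_iff
        by (simp add: sum_subtractf sum_negf sum.distrib algebra_simps)
    qed
  qed
qed

section \<open>Dominance of a fixed vector by independent rows\<close>

lemma prob_ge:
  assumes "i \<ge> 1" "j \<ge> 1"
  shows "prob (XX i j -` {x..} \<inter> space M) = S x"
proof -
  note [measurable] = rv_XX[OF assms]
  have "prob (XX i j -` {x..} \<inter> space M) = measure (distr M borel (XX i j)) {x..}"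
    by (simp add: measure_distr)
  also have "\<dots> = S x"
    unfolding law[OF assms] surv_def by (auto simp: measure_distr intro!: arg_cong[where f = prob])
  finally show ?thesis .
qed

lemma prob_row_ge:
  assumes j: "j \<ge> 1"
  shows "prob {\<omega> \<in> space M. \<forall>i\<in>{1..m}. v i \<le> XX j i \<omega>} = (\<Prod>i\<in>{1..m}. S (v i))"
\<comment> \<open>Independence of events is used for a nonempty index set; with no coordinates both
  sides are 1.\<close>
proof (cases "m = 0")
  case False
  have "{\<omega> \<in> space M. \<forall>i\<in>{1..m}. v i \<le> XX j i \<omega>}
      = (\<Inter>p\<in>{j} \<times> {1..m}. (case p of (i, j) \<Rightarrow> XX i j) -` {v (snd p)..} \<inter> space M)"
    using False by auto
  also have "prob \<dots> = (\<Prod>p\<in>{j} \<times> {1..m}. prob ((case p of (i, j) \<Rightarrow> XX i j) -` {v (snd p)..} \<inter> space M))"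
    by (rule indep_varsD[OF indep]) (use False j in auto)
  also have "\<dots> = (\<Prod>p\<in>{j} \<times> {1..m}. S (v (snd p)))"
    using j prob_ge by (intro prod.cong) auto
  also have "\<dots> = (\<Prod>i\<in>{1..m}. S (v i))"
    by (simp add: prod.cartesian_product')
  finally show ?thesis .
qed (simp add: prob_space)

text \<open>Distinct rows use disjoint blocks of the array, so the \<open>N - 1\<close> failures to
  dominate \<open>v\<close> are independent. For \<open>N < 2\<close> the truncated exponent is 0
  and both sides are 1.\<close>

lemma prob_no_row_ge:
  "prob {\<omega> \<in> space M. \<forall>j\<in>{2..N}. \<not> (\<forall>i\<in>{1..m}. v i \<le> XX j i \<omega>)} = (1 - (\<Prod>i\<in>{1..m}. S (v i))) ^ (N - 1)"
proof (cases "N \<ge> 2")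
  case True
  define K :: "nat \<Rightarrow> (nat \<times> nat) set" where "K j = {j} \<times> {1..m}" for j
  \<comment> \<open>The whole row \<open>j\<close> as one random element, so that independence can
    be grouped by rows.\<close>
  define R where "R j \<omega> = (\<lambda>p\<in>K j. case p of (i, j) \<Rightarrow> XX i j \<omega>)" for j \<omega>
  define A where "A j = {w \<in> space (Pi\<^sub>M (K j) (\<lambda>_. borel :: real measure)). \<not> (\<forall>i\<in>{1..m}. v i \<le> w (j, i))}" for j
  have "indep_vars (\<lambda>j. Pi\<^sub>M (K j) (\<lambda>_. borel)) (\<lambda>j \<omega>. restrict (\<lambda>p. (case p of (i, j) \<Rightarrow> XX i j) \<omega>) (K j)) {2..N}"
    by (rule indep_vars_restrict[OF indep]) (auto simp: K_def disjoint_family_on_def)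
  then have ind: "indep_vars (\<lambda>j. Pi\<^sub>M (K j) (\<lambda>_. borel)) R {2..N}"
    by (simp add: R_def[abs_def] case_prod_beta')
  have A: "A j \<in> sets (Pi\<^sub>M (K j) (\<lambda>_. borel))" for j
  proof -
    have "(\<lambda>w. w (j, i)) \<in> borel_measurable (Pi\<^sub>M (K j) (\<lambda>_. borel :: real measure))" if "i \<in> {1..m}" for i
      using that by (intro measurable_component_singleton) (auto simp: K_def)
    then have "Measurable.pred (Pi\<^sub>M (K j) (\<lambda>_. borel :: real measure)) (\<lambda>w. \<not> (\<forall>i\<in>{1..m}. v i \<le> w (j, i)))"
      by (intro pred_intros_logic pred_intros_finite measurable_pred_le) auto
    then show ?thesis
      unfolding A_def by (simp add: pred_def)
  qed
  have RA: "R j -` A j \<inter> space M = {\<omega> \<in> space M. \<not> (\<forall>i\<in>{1..m}. v i \<le> XX j i \<omega>)}" for j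
    by (auto simp: R_def A_def K_def space_PiM)
  have "{\<omega> \<in> space M. \<forall>j\<in>{2..N}. \<not> (\<forall>i\<in>{1..m}. v i \<le> XX j i \<omega>)} = (\<Inter>j\<in>{2..N}. R j -` A j \<inter> space M)"
    unfolding RA using True by fastforce
  also have "prob \<dots> = (\<Prod>j\<in>{2..N}. prob (R j -` A j \<inter> space M))"
    using True A by (intro indep_varsD_finite[OF ind]) auto
  also have "\<dots> = (\<Prod>j\<in>{2..N}. 1 - (\<Prod>i\<in>{1..m}. S (v i)))"
  proof (rule prod.cong)
    fix j assume "j \<in> {2..N}"
    then have j: "j \<ge> 1" by auto
    have "Measurable.pred M (\<lambda>\<omega>. \<forall>i\<in>{1..m}. v i \<le> XX j i \<omega>)"
      using j by (intro pred_intros_finite measurable_pred_le) (auto intro: rv_XX)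
    then have "prob {\<omega> \<in> space M. \<not> (\<forall>i\<in>{1..m}. v i \<le> XX j i \<omega>)}
      = 1 - prob {\<omega> \<in> space M. \<forall>i\<in>{1..m}. v i \<le> XX j i \<omega>}"
      by (intro prob_neg) (simp add: pred_def)
    then show "prob (R j -` A j \<inter> space M) = 1 - (\<Prod>i\<in>{1..m}. S (v i))"
      unfolding RA prob_row_ge[OF j] .
  qed simp
  also have "\<dots> = (1 - (\<Prod>i\<in>{1..m}. S (v i))) ^ (N - 1)"
    by (simp add: numeral_2_eq_2 Suc_diff_Suc)
  finally show ?thesis .
qed (simp add: prob_space)

end

subsection \<open>Conditioning on the first vector\<close>

context iid_array
begin

text \<open>The first row and the rows in \<open>J\<close> occupy disjoint blocks, so the first may
  be frozen at \<open>v\<close> by \<open>prob_indep_pair_le\<close>. The truth value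
  \<open>b\<close> lets one statement serve both dominance and its absence, and \<open>B\<close>
  records which values of \<open>Q m\<close> are considered.\<close>

lemma prob_dom_conditional_le:
  assumes J: "finite J" "J \<subseteq> {2..}" and B[measurable]: "B \<in> sets borel" and p: "0 \<le> p"
    and le: "\<And>v. (\<Prod>i\<in>{1..m}. S (v i)) \<in> B \<Longrightarrow>
      prob {\<omega> \<in> space M. (\<exists>j\<in>J. \<forall>i\<in>{1..m}. v i \<le> XX j i \<omega>) = b} \<le> p"
  shows "prob {\<omega> \<in> space M. Q m \<omega> \<in> B \<and> (\<exists>j\<in>J. dominates m j \<omega>) = b} \<le> p"
proof -
  define K1 :: "(nat \<times> nat) set" where "K1 = {1} \<times> {1..m}"
  define K2 :: "(nat \<times> nat) set" where "K2 = J \<times> {1..m}"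
  define P :: "(nat \<times> nat \<Rightarrow> real) measure" where "P = Pi\<^sub>M K1 (\<lambda>_. borel)"
  define P' :: "(nat \<times> nat \<Rightarrow> real) measure" where "P' = Pi\<^sub>M K2 (\<lambda>_. borel)"
  define V where "V \<omega> = (\<lambda>p\<in>K1. case p of (i, j) \<Rightarrow> XX i j \<omega>)" for \<omega>
  define W where "W \<omega> = (\<lambda>p\<in>K2. case p of (i, j) \<Rightarrow> XX i j \<omega>)" for \<omega>
  define A where "A = {z \<in> space (P \<Otimes>\<^sub>M P'). (\<Prod>i\<in>{1..m}. S (fst z (1, i))) \<in> B \<and>
    (\<exists>j\<in>J. \<forall>i\<in>{1..m}. fst z (1, i) \<le> snd z (j, i)) = b}"
  have "indep_var P (\<lambda>\<omega>. restrict (\<lambda>p. (case p of (i, j) \<Rightarrow> XX i j) \<omega>) K1)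
                  P' (\<lambda>\<omega>. restrict (\<lambda>p. (case p of (i, j) \<Rightarrow> XX i j) \<omega>) K2)"
    unfolding P_def P'_def
    by (rule indep_var_restrict[OF indep]) (use J in \<open>auto simp: K1_def K2_def\<close>)
  then have ind: "indep_var P V P' W"
    by (simp add: V_def[abs_def] W_def[abs_def] case_prod_beta')
  have m1: "(\<lambda>z. fst z (1, i)) \<in> borel_measurable (P \<Otimes>\<^sub>M P')" if "i \<in> {1..m}" for i
    unfolding P_def using that
    by (intro measurable_compose[OF measurable_fst measurable_component_singleton]) (auto simp: K1_def)
  have m2: "(\<lambda>z. snd z (j, i)) \<in> borel_measurable (P \<Otimes>\<^sub>M P')" if "i \<in> {1..m}" "j \<in> J" for i j
    unfolding P'_def using that
    by (intro measurable_compose[OF measurable_snd measurable_component_singleton]) (auto simp: K2_def)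
  have pr: "(\<lambda>z. \<Prod>i\<in>{1..m}. S (fst z (1, i))) \<in> borel_measurable (P \<Otimes>\<^sub>M P')"
    by (intro borel_measurable_prod measurable_compose[OF m1 measurable_S])
  have dm: "Measurable.pred (P \<Otimes>\<^sub>M P') (\<lambda>z. \<exists>j\<in>J. \<forall>i\<in>{1..m}. fst z (1, i) \<le> snd z (j, i))"
    by (intro pred_intros_finite J measurable_pred_le m1 m2) auto
  have A: "A \<in> sets (P \<Otimes>\<^sub>M P')"
    unfolding A_def using pr dm by measurable
  have "{\<omega> \<in> space M. Q m \<omega> \<in> B \<and> (\<exists>j\<in>J. dominates m j \<omega>) = b} = {\<omega> \<in> space M. (V \<omega>, W \<omega>) \<in> A}"
  proof (intro Collect_cong conj_cong refl)
    fix \<omega> assume "\<omega> \<in> space M"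
    have "(V \<omega>, W \<omega>) \<in> space (P \<Otimes>\<^sub>M P')"
      by (auto simp: P_def P'_def space_pair_measure space_PiM V_def W_def)
    moreover have "Q m \<omega> = (\<Prod>i\<in>{1..m}. S (V \<omega> (1, i)))"
      by (intro prod.cong refl) (simp add: V_def K1_def)
    moreover have "V \<omega> (1, i) = XX 1 i \<omega>" if "i \<in> {1..m}" for i
      using that by (auto simp: V_def K1_def)
    moreover have "W \<omega> (j, i) = XX j i \<omega>" if "i \<in> {1..m}" "j \<in> J" for i j
      using that by (auto simp: W_def K2_def)
    ultimately show "(Q m \<omega> \<in> B \<and> (\<exists>j\<in>J. dominates m j \<omega>) = b) = ((V \<omega>, W \<omega>) \<in> A)"
      by (simp add: A_def prod_le_def)
  qed
  also have "prob \<dots> \<le> p"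
  proof (rule prob_indep_pair_le[OF ind A _ p])
    fix v assume v: "v \<in> space P"
    show "prob {\<omega> \<in> space M. (v, W \<omega>) \<in> A} \<le> p"
    proof (cases "(\<Prod>i\<in>{1..m}. S (v (1, i))) \<in> B")
      case True
      have "{\<omega> \<in> space M. (v, W \<omega>) \<in> A}
          = {\<omega> \<in> space M. (\<exists>j\<in>J. \<forall>i\<in>{1..m}. v (1, i) \<le> XX j i \<omega>) = b}"
      proof (intro Collect_cong conj_cong refl)
        fix \<omega>
        have "(v, W \<omega>) \<in> space (P \<Otimes>\<^sub>M P')"
          using v by (auto simp: P'_def space_pair_measure space_PiM W_def)
        moreover have "W \<omega> (j, i) = XX j i \<omega>" if "i \<in> {1..m}" "j \<in> J" for i j
          using that by (auto simp: W_def K2_def)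
        ultimately show "((v, W \<omega>) \<in> A) = ((\<exists>j\<in>J. \<forall>i\<in>{1..m}. v (1, i) \<le> XX j i \<omega>) = b)"
          using True by (simp add: A_def)
      qed
      then show ?thesis
        using le[OF True] by simp
    next
      \<comment> \<open>The constraint on \<open>Q m\<close> depends on \<open>v\<close> alone; if
        it fails, the section is empty.\<close>
      case False
      then have "{\<omega> \<in> space M. (v, W \<omega>) \<in> A} = {}"
        by (auto simp: A_def)
      from p show ?thesis
        unfolding \<open>_ = {}\<close> measure_empty .
    qed
  qed
  finally show ?thesis .
qed

text \<open>Union bound over the competitors; each one alone dominates a frozen first vector with
  probability equal to the product, hence at most \<open>q\<close>.\<close>

lemma prob_dom_and_Q_le:
  assumes "0 \<le> q"
  shows "prob {\<omega> \<in> space M. Q m \<omega> \<le> q \<and> (\<exists>j\<in>{2..N}. dominates m j \<omega>)} \<le> real N * q"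
proof -
  have single: "prob {\<omega> \<in> space M. Q m \<omega> \<le> q \<and> dominates m j \<omega>} \<le> q" if j: "j \<in> {2..N}" for j
  proof -
    have "j \<ge> 1" using j by simp
    then have "prob {\<omega> \<in> space M. Q m \<omega> \<in> {..q} \<and> (\<exists>j\<in>{j}. dominates m j \<omega>) = True} \<le> q"
      using j assms prob_row_ge by (intro prob_dom_conditional_le) auto
    then show ?thesis by simp
  qed
  have meas: "{\<omega> \<in> space M. Q m \<omega> \<le> q \<and> dominates m j \<omega>} \<in> events" if "j \<in> {2..N}" for j
  proof -
    have [measurable]: "Measurable.pred M (dominates m j)"
      using that by (intro measurable_dom) simp
    show ?thesis by measurable
  qed
  have "prob {\<omega> \<in> space M. Q m \<omega> \<le> q \<and> (\<exists>j\<in>{2..N}. dominates m j \<omega>)}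
      = prob (\<Union>j\<in>{2..N}. {\<omega> \<in> space M. Q m \<omega> \<le> q \<and> dominates m j \<omega>})"
    by (intro arg_cong[where f = prob]) auto
  also have "\<dots> \<le> (\<Sum>j\<in>{2..N}. prob {\<omega> \<in> space M. Q m \<omega> \<le> q \<and> dominates m j \<omega>})"
    using meas by (intro finite_measure_subadditive_finite) auto
  also have "\<dots> \<le> (\<Sum>j\<in>{2..N}. q)"
    by (intro sum_mono single)
  also have "\<dots> \<le> real N * q"
    using assms by (auto intro!: mult_right_mono)
  finally show ?thesis .
qed

text \<open>For a frozen first vector the probability is given exactly by
  \<open>prob_no_row_ge\<close>, and it decreases as the product grows.\<close>

lemma prob_no_dom_and_Q_ge:
  assumes "q \<le> 1"
  shows "prob {\<omega> \<in> space M. q \<le> Q m \<omega> \<and> \<not> (\<exists>j\<in>{2..N}. dominates m j \<omega>)} \<le> (1 - q) ^ (N - 1)"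
proof -
  have "prob {\<omega> \<in> space M. Q m \<omega> \<in> {q..} \<and> (\<exists>j\<in>{2..N}. dominates m j \<omega>) = False} \<le> (1 - q) ^ (N - 1)"
  proof (rule prob_dom_conditional_le)
    fix v :: "nat \<Rightarrow> real"
    assume v: "(\<Prod>i\<in>{1..m}. S (v i)) \<in> {q..}"
    have "(\<Prod>i\<in>{1..m}. S (v i)) \<le> 1"
      by (intro prod_le_1) (auto simp: surv_nonneg surv_le_1)
    with v have "(1 - (\<Prod>i\<in>{1..m}. S (v i))) ^ (N - 1) \<le> (1 - q) ^ (N - 1)"
      by (intro power_mono) auto
    with prob_no_row_ge[of N m v]
    show "prob {\<omega> \<in> space M. (\<exists>j\<in>{2..N}. \<forall>i\<in>{1..m}. v i \<le> XX j i \<omega>) = False} \<le> (1 - q) ^ (N - 1)"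
      by simp
  qed (use assms in auto)
  then show ?thesis by simp
qed

text \<open>On the typical event for \<open>Q m\<close>, the union bound is
  \<open>exp (m / c)\<close> times \<open>exp (- (\<gamma> - \<epsilon>) m)\<close>, which decays
  geometrically.\<close>

lemma AE_eventually_no_dom:
  assumes c: "0 < c" "1 / c < gam M X"
  shows "AE \<omega> in M. eventually (\<lambda>m. \<not> (\<exists>j\<in>{2..nat \<lfloor>exp (real m / c)\<rfloor>}. dominates m j \<omega>)) sequentially"
proof -
  \<comment> \<open>Half of the gap: one half pays for the fluctuation of \<open>Q m\<close>, the
    other remains as the decay rate.\<close>
  define \<epsilon> where "\<epsilon> = (gam M X - 1 / c) / 2"
  have \<epsilon>: "\<epsilon> > 0" "1 / c - (gam M X - \<epsilon>) = - \<epsilon>"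
    using c by (auto simp: \<epsilon>_def field_simps)
  define q where "q m = exp (- (gam M X - \<epsilon>) * real m)" for m
  have "AE \<omega> in M. eventually (\<lambda>m. \<not> (Q m \<omega> \<le> q m \<and>
      (\<exists>j\<in>{2..nat \<lfloor>exp (real m / c)\<rfloor>}. dominates m j \<omega>))) sequentially"
  proof (rule AE_eventually_not_if_summable_bound)
    fix m
    show "{\<omega> \<in> space M. Q m \<omega> \<le> q m \<and> (\<exists>j\<in>{2..nat \<lfloor>exp (real m / c)\<rfloor>}. dominates m j \<omega>)} \<in> events"
      using measurable_Q[of m] by (intro sets.sets_Collect_conj sets.sets_Collect_finite_Ex
        borel_measurable_le predE measurable_dom) auto
    have "prob {\<omega> \<in> space M. Q m \<omega> \<le> q m \<and> (\<exists>j\<in>{2..nat \<lfloor>exp (real m / c)\<rfloor>}. dominates m j \<omega>)}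
        \<le> real (nat \<lfloor>exp (real m / c)\<rfloor>) * q m"
      by (rule prob_dom_and_Q_le) (simp add: q_def)
    also have "\<dots> \<le> exp (real m / c) * q m"
      by (intro mult_right_mono) (auto simp: q_def)
    also have "\<dots> = exp (real m * (1 / c - (gam M X - \<epsilon>)))"
      unfolding q_def by (simp add: exp_add[symmetric] algebra_simps)
    also have "\<dots> = exp (- \<epsilon>) ^ m"
      unfolding \<epsilon>(2) by (simp only: exp_of_nat_mult)
    finally show "prob {\<omega> \<in> space M. Q m \<omega> \<le> q m \<and>
        (\<exists>j\<in>{2..nat \<lfloor>exp (real m / c)\<rfloor>}. dominates m j \<omega>)} \<le> exp (- \<epsilon>) ^ m" .
  next
    show "summable (\<lambda>m. exp (- \<epsilon>) ^ m)"
      using \<epsilon>(1) by (intro summable_geometric) simp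
  qed (rule finite_measure_axioms)
  moreover have "AE \<omega> in M. eventually (\<lambda>m. exp (- (gam M X + \<epsilon>) * real m) \<le> Q m \<omega> \<and>
    Q m \<omega> \<le> exp (- (gam M X - \<epsilon>) * real m)) sequentially"
    by (rule AE_Q_bounds) fact
  ultimately show ?thesis
  proof eventually_elim
    case (elim \<omega>)
    then show ?case
      by eventually_elim (auto simp: q_def)
  qed
qed

text \<open>The expected number of dominating vectors now grows like
  \<open>exp (\<epsilon> m)\<close>, and \<open>1 - q \<le> exp (- q)\<close> makes it very unlikely
  that there are none.\<close>

lemma AE_eventually_dom:
  assumes c: "0 < c" "gam M X < 1 / c"
  shows "AE \<omega> in M. eventually (\<lambda>m. \<exists>j\<in>{2..nat \<lfloor>exp (real m / c)\<rfloor>}. dominates m j \<omega>) sequentially"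
proof -
  define \<epsilon> where "\<epsilon> = (1 / c - gam M X) / 2"
  have \<epsilon>: "\<epsilon> > 0" "1 / c - (gam M X + \<epsilon>) = \<epsilon>"
    using c by (auto simp: \<epsilon>_def field_simps)
  define q where "q m = exp (- (gam M X + \<epsilon>) * real m)" for m
  have q: "0 \<le> q m" "q m \<le> 1" for m
    using gam_nonneg[of X] \<epsilon>(1) by (auto simp: q_def intro!: mult_nonpos_nonneg)
  have "AE \<omega> in M. eventually (\<lambda>m. \<not> (q m \<le> Q m \<omega> \<and>
      \<not> (\<exists>j\<in>{2..nat \<lfloor>exp (real m / c)\<rfloor>}. dominates m j \<omega>))) sequentially"
  proof (rule AE_eventually_not_if_summable_bound)
    fix m
    define N where "N = nat \<lfloor>exp (real m / c)\<rfloor>"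
    show "{\<omega> \<in> space M. q m \<le> Q m \<omega> \<and> \<not> (\<exists>j\<in>{2..nat \<lfloor>exp (real m / c)\<rfloor>}. dominates m j \<omega>)} \<in> events"
      using measurable_Q[of m] by (intro sets.sets_Collect_conj sets.sets_Collect_neg sets.sets_Collect_finite_Ex
        borel_measurable_le predE measurable_dom) auto
    \<comment> \<open>One unit is lost to the floor and one to leaving out the first vector.\<close>
    have N: "exp (real m / c) - 2 \<le> real (N - 1)"
      unfolding N_def by linarith
    have "prob {\<omega> \<in> space M. q m \<le> Q m \<omega> \<and> \<not> (\<exists>j\<in>{2..N}. dominates m j \<omega>)} \<le> (1 - q m) ^ (N - 1)"
      by (rule prob_no_dom_and_Q_ge) (rule q)
    also have "\<dots> \<le> exp (- q m) ^ (N - 1)"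
      using q[of m] exp_ge_add_one_self[of "- q m"] by (intro power_mono) auto
    also have "\<dots> = exp (- (real (N - 1) * q m))"
      by (simp add: exp_of_nat_mult[symmetric])
    also have "\<dots> \<le> exp (2 - \<epsilon> * real m)"
    proof -
      \<comment> \<open>The exponential growth is weakened to linear growth, which is enough for a
        geometric bound. As \<open>q m \<le> 1\<close>, the two lost units cost only the factor
        \<open>exp 2\<close>.\<close>
      have "\<epsilon> * real m \<le> exp (\<epsilon> * real m)"
        using exp_ge_add_one_self[of "\<epsilon> * real m"] by linarith
      also have "\<dots> = exp (real m * (1 / c - (gam M X + \<epsilon>)))"
        unfolding \<epsilon>(2) by (simp add: mult.commute)
      also have "\<dots> = exp (real m / c) * q m"
        unfolding q_def by (simp add: exp_add[symmetric] algebra_simps)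
      also have "\<dots> \<le> (real (N - 1) + 2) * q m"
        using N q[of m] by (intro mult_right_mono) auto
      also have "\<dots> \<le> real (N - 1) * q m + 2"
        using q[of m] by (simp add: algebra_simps)
      finally show ?thesis by simp
    qed
    also have "\<dots> = exp 2 * exp (- \<epsilon>) ^ m"
      by (simp add: exp_of_nat_mult[symmetric] exp_add[symmetric] mult.commute)
    finally show "prob {\<omega> \<in> space M. q m \<le> Q m \<omega> \<and>
        \<not> (\<exists>j\<in>{2..nat \<lfloor>exp (real m / c)\<rfloor>}. dominates m j \<omega>)} \<le> exp 2 * exp (- \<epsilon>) ^ m"
      unfolding N_def .
  next
    show "summable (\<lambda>m. exp 2 * exp (- \<epsilon>) ^ m)"
      using \<epsilon>(1) by (intro summable_mult summable_geometric) simp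
  qed (rule finite_measure_axioms)
  moreover have "AE \<omega> in M. eventually (\<lambda>m. exp (- (gam M X + \<epsilon>) * real m) \<le> Q m \<omega> \<and>
    Q m \<omega> \<le> exp (- (gam M X - \<epsilon>) * real m)) sequentially"
    by (rule AE_Q_bounds) fact
  ultimately show ?thesis
  proof eventually_elim
    case (elim \<omega>)
    then show ?case
      by eventually_elim (auto simp: q_def)
  qed
qed

section \<open>Transfer from the dimension \<open>m\<close> to the sequence
  \<open>k n\<close>\<close>

lemma one_in_maxima_iff:
  assumes "n \<ge> 1"
  shows "1 \<in> maxima m n (\<lambda>i j. XX i j \<omega>) \<longleftrightarrow> \<not> (\<exists>j\<in>{2..n}. dominates m j \<omega>)"
proof -
  have "{2..n} = {1..n} - {1}"
    by auto
  then show ?thesis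
    using assms unfolding maxima_def is_strong_max_def by auto
qed

text \<open>For \<open>c\<close> strictly between \<open>1 / \<gamma>\<close> and the lower limit,
  eventually \<open>n \<le> exp (k n / c)\<close>. The competitors up to \<open>n\<close> are thus
  among those excluded for \<open>m = k n\<close>.\<close>

lemma AE_one_in_maxima:
  assumes lim: "liminf (\<lambda>n. ereal (real (k n) / ln (real n))) > 1 / ereal (gam M X)"
  shows "AE \<omega> in M. (\<lambda>n. indicator (maxima (k n) n (\<lambda>i j. XX i j \<omega>)) 1 :: real) \<longlonglongrightarrow> 1"
proof -
  \<comment> \<open>In \<open>ereal\<close> the reciprocal of 0 is \<infinity>, which no lower limit
    exceeds.\<close>
  have "gam M X \<noteq> 0"
  proof
    assume "gam M X = 0"
    then have "1 / ereal (gam M X) = \<infinity>"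
      by (simp add: divide_ereal_def)
    with lim show False by simp
  qed
  then have g: "gam M X > 0"
    using gam_nonneg[of X] by simp
  then have "ereal (1 / gam M X) < liminf (\<lambda>n. ereal (real (k n) / ln (real n)))"
    using lim by (simp add: one_ereal_def)
  then obtain c where c: "ereal (1 / gam M X) < ereal c" "ereal c < liminf (\<lambda>n. ereal (real (k n) / ln (real n)))"
    using ereal_dense2 by blast
  have c1: "1 / gam M X < c"
    using c(1) by simp
  moreover have "0 < 1 / gam M X"
    using g by simp
  ultimately have c0: "0 < c"
    by linarith
  with c1 g have c2: "1 / c < gam M X"
    by (simp add: divide_less_eq mult.commute)
  have "eventually (\<lambda>n. c < real (k n) / ln (real n)) sequentially"
    using less_LiminfD[OF c(2)] by simp
  \<comment> \<open>From \<open>n = 2\<close> on the logarithm is positive, so the quotient can be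
    cleared.\<close>
  then have kn: "eventually (\<lambda>n. n \<ge> 1 \<and> c * ln (real n) < real (k n)) sequentially"
    using eventually_ge_at_top[of 2] by eventually_elim (auto simp: field_simps)
  have "filterlim (\<lambda>n. c * ln (real n)) at_top sequentially"
    using c0 by (intro filterlim_tendsto_pos_mult_at_top[OF tendsto_const]
        filterlim_compose[OF ln_at_top] filterlim_real_sequentially)
  then have "filterlim (\<lambda>n. real (k n)) at_top sequentially"
    by (rule filterlim_at_top_mono) (use kn in \<open>auto elim: eventually_mono\<close>)
  then have k: "filterlim k at_top sequentially"
    by (simp add: filterlim_sequentially_iff_filterlim_real)
  show ?thesis
    using AE_eventually_no_dom[OF c0 c2]
  proof eventually_elim
    case (elim \<omega>)
    from eventually_compose_filterlim[OF elim k] kn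
    have "eventually (\<lambda>n. indicator (maxima (k n) n (\<lambda>i j. XX i j \<omega>)) 1 = (1 :: real)) sequentially"
    proof eventually_elim
      case (elim n)
      then have "ln (real n) \<le> real (k n) / c"
        using c0 by (simp add: field_simps)
      then have "real n \<le> exp (real (k n) / c)"
        using elim(2) by (metis exp_le_cancel_iff exp_ln of_nat_0_less_iff less_le_trans zero_less_one)
      then have "n \<le> nat \<lfloor>exp (real (k n) / c)\<rfloor>"
        by (simp add: le_nat_floor)
      then have "\<not> (\<exists>j\<in>{2..n}. dominates (k n) j \<omega>)"
        using elim(1) by (meson atLeastAtMost_iff le_trans)
      then show ?case
        using elim(2) one_in_maxima_iff[of n "k n" \<omega>] by simp
    qed
    then show ?case
      by (rule tendsto_eventually)
  qed
qed

text \<open>\<open>k n\<close> need not tend to infinity here, so the almost sure statement is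
  applied at the larger dimension \<open>K n\<close>. A vector dominating there also dominates in
  dimension \<open>k n\<close>.\<close>

lemma AE_one_not_in_maxima:
  assumes lim: "limsup (\<lambda>n. ereal (real (k n) / ln (real n))) < 1 / ereal (gam M X)"
  shows "AE \<omega> in M. (\<lambda>n. indicator (maxima (k n) n (\<lambda>i j. XX i j \<omega>)) 1 :: real) \<longlonglongrightarrow> 0"
proof -
  have "0 < 1 / ereal (gam M X)"
    using gam_nonneg[of X] by (cases "gam M X = 0") (auto simp: divide_ereal_def one_ereal_def)
  \<comment> \<open>The maximum with 0 forces the intermediate \<open>c\<close> to be positive. The
    reciprocal may be \<infinity> here, when \<open>\<gamma>\<close> is 0.\<close>
  with lim have "max 0 (limsup (\<lambda>n. ereal (real (k n) / ln (real n)))) < 1 / ereal (gam M X)"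
    by simp
  then obtain c where c: "max 0 (limsup (\<lambda>n. ereal (real (k n) / ln (real n)))) < ereal c"
      "ereal c < 1 / ereal (gam M X)"
    using ereal_dense2 by blast
  have c0: "0 < c"
    using c(1) by simp
  have c1: "gam M X < 1 / c"
    using c(2) c0 gam_nonneg[of X]
    by (cases "gam M X = 0") (auto simp: one_ereal_def field_simps)
  have "eventually (\<lambda>n. real (k n) / ln (real n) < c) sequentially"
    using Limsup_lessD[of _ "\<lambda>n. ereal (real (k n) / ln (real n))" "ereal c"] c(1) by simp
  then have kn: "eventually (\<lambda>n. n \<ge> 1 \<and> real (k n) < c * ln (real n)) sequentially"
    using eventually_ge_at_top[of 2] by eventually_elim (auto simp: field_simps)
  define K where "K n = nat \<lfloor>c * ln (real n)\<rfloor>" for n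
  have "filterlim (\<lambda>n. c * ln (real n)) at_top sequentially"
    using c0 by (intro filterlim_tendsto_pos_mult_at_top[OF tendsto_const]
        filterlim_compose[OF ln_at_top] filterlim_real_sequentially)
  then have K: "filterlim K at_top sequentially"
    unfolding K_def
    by (intro filterlim_compose[OF filterlim_nat_sequentially] filterlim_compose[OF filterlim_floor_sequentially])
  show ?thesis
    using AE_eventually_dom[OF c0 c1]
  proof eventually_elim
    case (elim \<omega>)
    from eventually_compose_filterlim[OF elim K] kn
    have "eventually (\<lambda>n. indicator (maxima (k n) n (\<lambda>i j. XX i j \<omega>)) 1 = (0 :: real)) sequentially"
    proof eventually_elim
      case (elim n)
      then have kK: "k n \<le> K n"
        unfolding K_def by (simp add: le_nat_floor)
      have "real (K n) \<le> c * ln (real n)"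
        using elim(2) c0 unfolding K_def by simp
      then have "real (K n) / c \<le> ln (real n)"
        using c0 by (simp add: field_simps)
      then have "exp (real (K n) / c) \<le> real n"
        using elim(2) by (metis exp_le_cancel_iff exp_ln of_nat_0_less_iff less_le_trans zero_less_one)
      \<comment> \<open>Rounding \<open>c * ln n\<close> down keeps the number of vectors required
        at dimension \<open>K n\<close> within the \<open>n\<close> available.\<close>
      then have "nat \<lfloor>exp (real (K n) / c)\<rfloor> \<le> n"
        by linarith
      with elim(1) obtain j where "j \<in> {2..n}" "dominates (K n) j \<omega>"
        by force
      then have "\<exists>j\<in>{2..n}. dominates (k n) j \<omega>"
        using kK by (intro bexI[of _ j]) (auto simp: prod_le_def)
      then show ?case
        using elim(2) one_in_maxima_iff[of n "k n" \<omega>] by simp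
    qed
    then show ?case
      by (rule tendsto_eventually)
  qed
qed

end

theorem theorem1:
  fixes M :: "'a measure"
    and XX :: "nat \<Rightarrow> nat \<Rightarrow> 'a \<Rightarrow> real"
    and X :: "'a \<Rightarrow> real"
    and F :: "real \<Rightarrow> real"
    and k :: "nat \<Rightarrow> nat"
  assumes "prob_space M"
    and "prob_space.indep_vars M (\<lambda>_. borel) (\<lambda>(i, j). XX i j) ({1..} \<times> {1..})"
    and "\<And>i j. i \<ge> 1 \<Longrightarrow> j \<ge> 1 \<Longrightarrow> cdf (distr M borel (XX i j)) = F"
    and "X \<in> borel_measurable M"
    and "cdf (distr M borel X) = F"
    and "\<And>n. n \<ge> 1 \<Longrightarrow> k n \<ge> 1"
  shows "(liminf (\<lambda>n. ereal (real (k n) / ln (real n))) > 1 / ereal (gam M X) \<longrightarrow>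
            (AE \<omega> in M. (\<lambda>n. indicator (maxima (k n) n (\<lambda>i j. XX i j \<omega>)) 1 :: real) \<longlonglongrightarrow> 1))
       \<and> (limsup (\<lambda>n. ereal (real (k n) / ln (real n))) < 1 / ereal (gam M X) \<longrightarrow>
            (AE \<omega> in M. (\<lambda>n. indicator (maxima (k n) n (\<lambda>i j. XX i j \<omega>)) 1 :: real) \<longlonglongrightarrow> 0))"
proof -
  interpret prob_space M by fact
  have rv: "XX i j \<in> borel_measurable M" if "i \<ge> 1" "j \<ge> 1" for i j
    using assms(2) that by (auto simp: indep_vars_def)
  \<comment> \<open>A distribution function determines its law, so equality of the
    \<open>cdf\<close>s gives the equality of laws that the locale asks for.\<close>
  interpret iid_array M XX X
  proof unfold_locales
    fix i j :: nat assume "i \<ge> 1" "j \<ge> 1"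
    then show "distr M borel (XX i j) = distr M borel X"
      using assms rv by (intro cdf_unique real_distribution_distr) auto
  qed (use assms in auto)
  show ?thesis
    using AE_one_in_maxima AE_one_not_in_maxima by blast
qed

end
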